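(* Let $f\in\mathcal H_0(V)$ be nonconstant on $V$ and $\Lambda\in\mathbb R$ be such that for all $u\in V_I$ $$0=\begin{cases}\min\{\|\{\nabla f\}(u)\|_\infty-\Lambda f(u),\ \Delta_\infty f(u)\} & \text{if } f(u)>0,\\ \Delta_\infty f(u) & \text{if } f(u)=0,\\ \max\{-\|\{\nabla f\}(u)\|_\infty-\Lambda f(u),\ \Delta_\infty f(u)\} & \text{if } f(u)<0.\end{cases}$$ Then $(f,\Lambda)$ is a generalized $\infty$-eigenpair.
   Context: $G=(V,E,\omega)$ is a finite undirected weighted graph: $E\subset V\times V$ is symmetric and $\omega_{uv}=\omega_{vu}>0$ for $(u,v)\in E$; $u\sim v$ means $(u,v)\in E$. $B\subset V$ (possibly empty) is the boundary and $V_I=V\setminus B\neq\emptyset$ the set of internal nodes. $G$ is connected: if $B=\emptyset$ any two nodes are joined by a path; if $B\ne\emptyset$ the subgraph induced by $V_I$ is connected and at least one internal node is adjacent to $B$. $\mathcal H_0(V)=\{f:V\to\mathbb R:\ f=0 \text{ on } B\}$, identified with the space $\mathbb R^{V_I}$ of functions on $V_I$ (extension by zero). For $f\in\mathcal H_0(V)$: $\nabla f(u,v)=\omega_{uv}(f(v)-f(u))$ for $(u,v)\in E$; $\|f\|_\infty=\max_{u\in V}|f(u)|$; $\|\nabla f\|_\infty=\max_{(u,v)\in E}|\nabla f(u,v)|$. With $x^+=\max\{x,0\}$ and $x^-=\max\{-x,0\}$, set $\|\{\nabla f\}(u)\|_\infty=\max_{v\sim u}|\nabla f(u,v)|$, $\|\{\nabla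 f\}^{\pm}(u)\|_\infty=\max_{v\sim u}(\nabla f(u,v))^{\pm}$, and $\Delta_\infty f(u)=\|\{\nabla f\}^-(u)\|_\infty-\|\{\nabla f\}^+(u)\|_\infty$. Generalized $\infty$-eigenpair: let $\partial\|f\|_\infty$ and $\partial\|\nabla f\|_\infty\subset\mathbb R^{V_I}$ be the convex subdifferentials at $f$ of the convex functions $g\mapsto\|g\|_\infty$ and $g\mapsto\|\nabla g\|_\infty$ on $\mathbb R^{V_I}$ (w.r.t. the standard scalar product). $(f,\Lambda)$ is a generalized $\infty$-eigenpair if $\partial\|\nabla f\|_\infty\cap\Lambda\,\partial\|f\|_\infty\neq\emptyset$, i.e. there are $\zeta\in\partial\|\nabla f\|_\infty$ and $\xi\in\partial\|f\|_\infty$ with $\zeta=\Lambda\xi$. *)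

theory Defs
  imports "HOL-Analysis.Analysis"
begin

text \<open>Self-loops are neither required nor excluded; since the gradient vanishes on a loop,
  they affect none of the quantities below.\<close>

locale weighted_boundary_graph =
  fixes V :: "'v set" and E :: "('v \<times> 'v) set" and \<omega> :: "'v \<Rightarrow> 'v \<Rightarrow> real" and B :: "'v set"
  assumes finite_V: "finite V"
    and E_subset: "E \<subseteq> V \<times> V"
    and sym_E: "sym E"
    and weight_pos: "\<And>u v. (u, v) \<in> E \<Longrightarrow> \<omega> u v > 0"
    and weight_sym: "\<And>u v. (u, v) \<in> E \<Longrightarrow> \<omega> u v = \<omega> v u"
    and B_subset: "B \<subseteq> V"
    and internal_nonempty: "V - B \<noteq> {}"
    and connected_no_boundary: "B = {} \<Longrightarrow> \<forall>u\<in>V. \<forall>v\<in>V. (u, v) \<in> E\<^sup>*"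
    and connected_internal:
      "B \<noteq> {} \<Longrightarrow> \<forall>u\<in>V - B. \<forall>v\<in>V - B. (u, v) \<in> (E \<inter> (V - B) \<times> (V - B))\<^sup>*"
    and boundary_adjacent: "B \<noteq> {} \<Longrightarrow> \<exists>u\<in>V - B. \<exists>b\<in>B. (u, b) \<in> E"

text \<open>Functions on \<open>V\<close> are total functions on the vertex type. Fixing the value \<open>0\<close> outside \<open>V\<close>
  makes \<open>H0 V B\<close> an exact copy of \<open>\<real>\<close> to the power \<open>V - B\<close>, embedded through extension by zero.\<close>

definition H0 :: "'v set \<Rightarrow> 'v set \<Rightarrow> ('v \<Rightarrow> real) set" where
  "H0 V B = {f. (\<forall>u\<in>B. f u = 0) \<and> (\<forall>u. u \<notin> V \<longrightarrow> f u = 0)}"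

definition grad :: "('v \<Rightarrow> 'v \<Rightarrow> real) \<Rightarrow> ('v \<Rightarrow> real) \<Rightarrow> 'v \<Rightarrow> 'v \<Rightarrow> real" where
  "grad \<omega> f u v = \<omega> u v * (f v - f u)"

definition sup_norm :: "'v set \<Rightarrow> ('v \<Rightarrow> real) \<Rightarrow> real" where
  "sup_norm V f = Max ((\<lambda>u. \<bar>f u\<bar>) ` V)"

text \<open>The maxima below range over sets of edges or of neighbours. These sets are nonempty
  for a \<open>weighted_boundary_graph\<close> and \<open>u \<in> V - B\<close>, except possibly when \<open>B = {}\<close> and \<open>V\<close> is a singleton;
  in that case every function on \<open>V\<close> is constant.\<close>

definition grad_norm :: "('v \<times> 'v) set \<Rightarrow> ('v \<Rightarrow> 'v \<Rightarrow> real) \<Rightarrow> ('v \<Rightarrow> real) \<Rightarrow> real" where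
  "grad_norm E \<omega> f = Max ((\<lambda>(u, v). \<bar>grad \<omega> f u v\<bar>) ` E)"

definition local_norm ::
  "('v \<times> 'v) set \<Rightarrow> ('v \<Rightarrow> 'v \<Rightarrow> real) \<Rightarrow> ('v \<Rightarrow> real) \<Rightarrow> 'v \<Rightarrow> real" where
  "local_norm E \<omega> f u = Max {\<bar>grad \<omega> f u v\<bar> | v. (u, v) \<in> E}"

definition local_norm_pos ::
  "('v \<times> 'v) set \<Rightarrow> ('v \<Rightarrow> 'v \<Rightarrow> real) \<Rightarrow> ('v \<Rightarrow> real) \<Rightarrow> 'v \<Rightarrow> real" where
  "local_norm_pos E \<omega> f u = Max {max (grad \<omega> f u v) 0 | v. (u, v) \<in> E}"

definition local_norm_neg ::
  "('v \<times> 'v) set \<Rightarrow> ('v \<Rightarrow> 'v \<Rightarrow> real) \<Rightarrow> ('v \<Rightarrow> real) \<Rightarrow> 'v \<Rightarrow> real" where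
  "local_norm_neg E \<omega> f u = Max {max (- grad \<omega> f u v) 0 | v. (u, v) \<in> E}"

definition inf_laplacian ::
  "('v \<times> 'v) set \<Rightarrow> ('v \<Rightarrow> 'v \<Rightarrow> real) \<Rightarrow> ('v \<Rightarrow> real) \<Rightarrow> 'v \<Rightarrow> real" where
  "inf_laplacian E \<omega> f u = local_norm_neg E \<omega> f u - local_norm_pos E \<omega> f u"

text \<open>The convex subdifferential on \<open>H0 V B\<close>, with the standard scalar product on the
  coordinates in \<open>V - B\<close>; both the subgradients and the competitors \<open>g\<close> lie in \<open>H0 V B\<close>.\<close>

definition subdifferential ::
  "'v set \<Rightarrow> 'v set \<Rightarrow> (('v \<Rightarrow> real) \<Rightarrow> real) \<Rightarrow> ('v \<Rightarrow> real) \<Rightarrow> ('v \<Rightarrow> real) set" where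
  "subdifferential V B J f =
     {\<zeta> \<in> H0 V B. \<forall>g\<in>H0 V B. J g \<ge> J f + (\<Sum>u\<in>V - B. \<zeta> u * (g u - f u))}"

definition generalized_inf_eigenpair ::
  "'v set \<Rightarrow> ('v \<times> 'v) set \<Rightarrow> ('v \<Rightarrow> 'v \<Rightarrow> real) \<Rightarrow> 'v set \<Rightarrow> ('v \<Rightarrow> real) \<Rightarrow> real \<Rightarrow> bool" where
  "generalized_inf_eigenpair V E \<omega> B f \<Lambda> \<longleftrightarrow>
     subdifferential V B (grad_norm E \<omega>) f
       \<inter> (\<lambda>\<xi> u. \<Lambda> * \<xi> u) ` subdifferential V B (sup_norm V) f \<noteq> {}"

end

theory Submission
  imports Defs
begin

text \<open>
  Call a directed edge steep if the gradient along it equals \<open>L = grad_norm E \<omega> f\<close>, which is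
  positive because \<open>f\<close> is not constant. The equation for \<open>f\<close> makes steep edges continue: when
  \<open>inf_laplacian E \<omega> f v \<le> 0\<close> at an internal node, a steep edge into \<open>v\<close> forces a steep edge out
  of \<open>v\<close>. Following steep edges upwards, \<open>f\<close> strictly increases, so the walk stops; it can only
  stop at a boundary node or at an internal node \<open>y\<close> where the other alternative
  \<open>\<Lambda> * f y = L\<close> holds (\<open>exists_top\<close>). Replacing \<open>f\<close> by \<open>- f\<close>, which solves the same
  equation, gives a lower end \<open>x\<close> on the boundary or with \<open>\<Lambda> * f x = - L\<close>.
  The ends are not both on the boundary as \<open>f x < f y\<close>, so \<open>\<Lambda> > 0\<close>. At a node where \<open>\<bar>f\<bar>\<close> is
  maximal the equation yields \<open>\<Lambda> * sup_norm V f \<le> L\<close>, hence \<open>\<Lambda> = L / sup_norm V f\<close>, and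
  \<open>\<bar>f\<bar>\<close> is maximal at every internal end.

  The common element of the two subdifferentials is, up to scaling, the dipole
  \<open>\<delta>\<^sub>y - \<delta>\<^sub>x\<close> with boundary terms discarded. It is a subgradient of the gradient norm at \<open>f\<close>
  because \<open>f\<close> has the steepest possible growth along the walk from \<open>x\<close> to \<open>y\<close>
  (\<open>steep_path_increment\<close>), and of the sup norm because \<open>f\<close> has the largest possible modulus
  at those of \<open>x\<close>, \<open>y\<close> that are internal.
\<close>

definition dipole :: "'v set \<Rightarrow> real \<Rightarrow> 'v \<Rightarrow> 'v \<Rightarrow> 'v \<Rightarrow> real" where
  "dipole I c x y u = (if u \<in> I then c * (of_bool (u = y) - of_bool (u = x)) else 0)"

definition steep_edges ::
  "('v \<times> 'v) set \<Rightarrow> ('v \<Rightarrow> 'v \<Rightarrow> real) \<Rightarrow> ('v \<Rightarrow> real) \<Rightarrow> ('v \<times> 'v) set" where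
  "steep_edges E \<omega> f = {(u, v) \<in> E. grad \<omega> f u v = grad_norm E \<omega> f}"

section \<open>The symmetry \<open>f \<mapsto> - f\<close>\<close>

lemma grad_uminus: "grad \<omega> (\<lambda>u. - f u) u v = - grad \<omega> f u v"
  by (simp add: grad_def algebra_simps)

lemma grad_norm_uminus: "grad_norm E \<omega> (\<lambda>u. - f u) = grad_norm E \<omega> f"
  by (simp add: grad_norm_def grad_uminus)

lemma inf_laplacian_uminus: "inf_laplacian E \<omega> (\<lambda>u. - f u) u = - inf_laplacian E \<omega> f u"
  by (simp add: inf_laplacian_def local_norm_pos_def local_norm_neg_def grad_uminus)

lemma local_norm_uminus: "local_norm E \<omega> (\<lambda>u. - f u) u = local_norm E \<omega> f u"
  by (simp add: local_norm_def grad_uminus)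

context weighted_boundary_graph
begin

definition inf_eigen_solution :: "real \<Rightarrow> ('v \<Rightarrow> real) \<Rightarrow> bool" where
  "inf_eigen_solution \<Lambda> f \<longleftrightarrow> (\<forall>u\<in>V - B.
     0 = (if f u > 0 then min (local_norm E \<omega> f u - \<Lambda> * f u) (inf_laplacian E \<omega> f u)
          else if f u = 0 then inf_laplacian E \<omega> f u
          else max (- local_norm E \<omega> f u - \<Lambda> * f u) (inf_laplacian E \<omega> f u)))"

text \<open>This symmetry turns every upward statement into a downward one.\<close>

lemma inf_eigen_solution_uminus:
  assumes "inf_eigen_solution \<Lambda> f"
  shows "inf_eigen_solution \<Lambda> (\<lambda>u. - f u)"
  unfolding inf_eigen_solution_def inf_laplacian_uminus local_norm_uminus
proof (rule ballI, goal_cases)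
  case (1 u)
  note eq = assms[unfolded inf_eigen_solution_def, THEN bspec, OF 1]
  show ?case
  proof (cases "f u" "0 :: real" rule: linorder_cases)
    case less
    with eq show ?thesis by (simp add: min_def max_def split: if_splits)
  next
    case equal
    with eq show ?thesis by simp
  next
    case greater
    with eq show ?thesis by (simp add: min_def max_def split: if_splits)
  qed
qed

section \<open>Local and global norms\<close>

lemma finite_E: "finite E"
  using finite_V E_subset by (meson finite_SigmaI finite_subset)

lemma finite_neighbours: "finite {v. (u, v) \<in> E}"
  using finite_E finite_subset[of "{v. (u, v) \<in> E}" "snd ` E"] by force

lemma abs_grad_le_grad_norm:
  assumes "(u, v) \<in> E"
  shows "\<bar>grad \<omega> f u v\<bar> \<le> grad_norm E \<omega> f"
  unfolding grad_norm_def using assms finite_E by (intro Max_ge) (auto intro: rev_image_eqI)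

lemma abs_le_sup_norm:
  assumes "u \<in> V"
  shows "\<bar>f u\<bar> \<le> sup_norm V f"
  unfolding sup_norm_def using assms finite_V by (intro Max_ge) auto

lemma sup_norm_attained:
  obtains u where "u \<in> V" "sup_norm V f = \<bar>f u\<bar>"
proof -
  have "sup_norm V f \<in> (\<lambda>u. \<bar>f u\<bar>) ` V"
    unfolding sup_norm_def using finite_V internal_nonempty by (intro Max_in) auto
  then show thesis using that by auto
qed

lemma grad_swap:
  assumes "(u, v) \<in> E"
  shows "grad \<omega> f v u = - grad \<omega> f u v"
  using weight_sym[OF assms] by (simp add: grad_def algebra_simps)

lemma steep_edges_uminus: "steep_edges E \<omega> (\<lambda>u. - f u) = (steep_edges E \<omega> f)\<inverse>"
proof -
  have "(u, v) \<in> steep_edges E \<omega> (\<lambda>u. - f u) \<longleftrightarrow> (v, u) \<in> steep_edges E \<omega> f" for u v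
  proof (cases "(u, v) \<in> E")
    case True
    then have "(v, u) \<in> E" using sym_E by (blast dest: symD)
    with True grad_swap[OF True, of f] show ?thesis
      by (simp add: steep_edges_def grad_uminus grad_norm_uminus)
  next
    case False
    then have "(v, u) \<notin> E" using sym_E by (blast dest: symD)
    with False show ?thesis by (simp add: steep_edges_def)
  qed
  then show ?thesis by auto
qed

lemma local_norm_le_grad_norm:
  assumes "(u, w) \<in> E"
  shows "local_norm E \<omega> f u \<le> grad_norm E \<omega> f"
proof -
  have "local_norm E \<omega> f u = Max ((\<lambda>v. \<bar>grad \<omega> f u v\<bar>) ` {v. (u, v) \<in> E})"
    unfolding local_norm_def by (rule arg_cong[where f = Max]) auto
  then show ?thesis
    using assms finite_neighbours abs_grad_le_grad_norm by (subst \<open>_ = _\<close>, subst Max_le_iff) auto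
qed

lemma abs_grad_le_local_norm:
  assumes "(u, v) \<in> E"
  shows "\<bar>grad \<omega> f u v\<bar> \<le> local_norm E \<omega> f u"
proof -
  have "local_norm E \<omega> f u = Max ((\<lambda>v. \<bar>grad \<omega> f u v\<bar>) ` {v. (u, v) \<in> E})"
    unfolding local_norm_def by (rule arg_cong[where f = Max]) auto
  then show ?thesis
    using assms finite_neighbours by (auto intro: Max_ge)
qed

lemma neg_grad_le_local_norm_neg:
  assumes "(u, v) \<in> E"
  shows "- grad \<omega> f u v \<le> local_norm_neg E \<omega> f u"
proof -
  have "local_norm_neg E \<omega> f u = Max ((\<lambda>v. max (- grad \<omega> f u v) 0) ` {v. (u, v) \<in> E})"
    unfolding local_norm_neg_def by (rule arg_cong[where f = Max]) auto
  moreover have "max (- grad \<omega> f u v) 0 \<le> \<dots>"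
    using assms finite_neighbours by (intro Max_ge) auto
  ultimately show ?thesis by linarith
qed

lemma local_norm_pos_attained:
  assumes "(u, w) \<in> E"
  obtains v where "(u, v) \<in> E" "local_norm_pos E \<omega> f u = max (grad \<omega> f u v) 0"
proof -
  have "local_norm_pos E \<omega> f u = Max ((\<lambda>v. max (grad \<omega> f u v) 0) ` {v. (u, v) \<in> E})"
    unfolding local_norm_pos_def by (rule arg_cong[where f = Max]) auto
  also have "\<dots> \<in> (\<lambda>v. max (grad \<omega> f u v) 0) ` {v. (u, v) \<in> E}"
    using assms finite_neighbours by (intro Max_in) auto
  finally show thesis using that by auto
qed

lemma zero_on_boundary:
  assumes "f \<in> H0 V B" "u \<notin> V - B"
  shows "f u = 0"
  using assms by (auto simp: H0_def)

section \<open>Steep edges and steep paths\<close>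

text \<open>Connectedness of the whole graph, in the form in which it is used: the boundary values
  \<open>0\<close> tie the boundary to the internal nodes even where no edge does.\<close>

lemma constant_if_grad_zero:
  assumes f: "f \<in> H0 V B"
    and edge: "\<And>u v. (u, v) \<in> E \<Longrightarrow> f u = f v"
  shows "\<exists>c. \<forall>u\<in>V. f u = c"
proof -
  have path: "f u = f v" if "(u, v) \<in> E\<^sup>*" for u v
    using that by (induction rule: rtrancl_induct) (auto dest: edge)
  show ?thesis
  proof (cases "B = {}")
    case True
    then show ?thesis using connected_no_boundary path by blast
  next
    case False
    then obtain u b where ub: "u \<in> V - B" "b \<in> B" "(u, b) \<in> E"
      using boundary_adjacent by blast
    have "f u = 0"
      using edge[OF ub(3)] zero_on_boundary[OF f] ub by auto
    moreover have "f u = f v" if "v \<in> V - B" for v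
    proof (rule path)
      have "(u, v) \<in> (E \<inter> (V - B) \<times> (V - B))\<^sup>*"
        using connected_internal False ub that by blast
      then show "(u, v) \<in> E\<^sup>*" by (rule rtrancl_mono[THEN subsetD, rotated]) auto
    qed
    ultimately have "\<forall>v\<in>V. f v = 0" using zero_on_boundary[OF f] by force
    then show ?thesis by blast
  qed
qed

lemma exists_steep_edge:
  assumes "f \<in> H0 V B" "\<not> (\<exists>c. \<forall>u\<in>V. f u = c)"
  shows "grad_norm E \<omega> f > 0" and "steep_edges E \<omega> f \<noteq> {}"
proof -
  obtain u v where uv: "(u, v) \<in> E" "f u \<noteq> f v"
    using constant_if_grad_zero assms by blast
  then have "\<bar>grad \<omega> f u v\<bar> > 0"
    using weight_pos[OF uv(1)] by (simp add: grad_def)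
  then show "grad_norm E \<omega> f > 0"
    using abs_grad_le_grad_norm[OF uv(1), of f] by linarith
  have "grad_norm E \<omega> f \<in> (\<lambda>(u, v). \<bar>grad \<omega> f u v\<bar>) ` E"
    unfolding grad_norm_def using finite_E uv(1) by (intro Max_in) auto
  then obtain a b where ab: "(a, b) \<in> E" "grad_norm E \<omega> f = \<bar>grad \<omega> f a b\<bar>" by auto
  moreover have "(b, a) \<in> E" using ab(1) sym_E by (blast dest: symD)
  ultimately have "(a, b) \<in> steep_edges E \<omega> f \<or> (b, a) \<in> steep_edges E \<omega> f"
    using grad_swap[OF ab(1), of f] unfolding steep_edges_def
    by (cases "grad \<omega> f a b < 0") simp_all
  then show "steep_edges E \<omega> f \<noteq> {}" by blast
qed

text \<open>Each edge limits the increment of \<open>g\<close> to \<open>grad_norm E \<omega> g / \<omega> u v\<close>, while \<open>f\<close> attains its own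
  limit on a steep edge. Dividing the two removes the weight, so the comparison of \<open>g\<close> with \<open>f\<close>
  adds up along a path of steep edges.\<close>

lemma steep_path_increment:
  assumes "(x, y) \<in> (steep_edges E \<omega> f)\<^sup>*"
  shows "grad_norm E \<omega> f * (g y - g x) \<le> grad_norm E \<omega> g * (f y - f x)"
  using assms
proof (induction rule: rtrancl_induct)
  case base
  then show ?case by simp
next
  case (step y z)
  then have yz: "(y, z) \<in> E" and L: "grad_norm E \<omega> f = \<omega> y z * (f z - f y)"
    by (auto simp: steep_edges_def grad_def)
  have "\<omega> y z * (g z - g y) \<le> grad_norm E \<omega> g"
    using abs_grad_le_grad_norm[OF yz, of g] by (simp add: grad_def)
  moreover have "0 \<le> f z - f y"
  proof -
    have "0 \<le> \<omega> y z * (f z - f y)"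
      using abs_grad_le_grad_norm[OF yz, of f] unfolding L by linarith
    then show ?thesis using weight_pos[OF yz] by (simp add: zero_le_mult_iff)
  qed
  ultimately have "\<omega> y z * (g z - g y) * (f z - f y) \<le> grad_norm E \<omega> g * (f z - f y)"
    by (rule mult_right_mono)
  then have "grad_norm E \<omega> f * (g z - g y) \<le> grad_norm E \<omega> g * (f z - f y)"
    unfolding L by (simp add: algebra_simps)
  with step.IH show ?case by (simp add: algebra_simps)
qed

lemma steep_edge_increases:
  assumes "(u, v) \<in> steep_edges E \<omega> f" "grad_norm E \<omega> f > 0"
  shows "f u < f v"
proof -
  have "(u, v) \<in> E" "0 < \<omega> u v * (f v - f u)"
    using assms by (auto simp: steep_edges_def grad_def)
  then have "0 < f v - f u" using weight_pos zero_less_mult_pos by blast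
  then show ?thesis by simp
qed

lemma steep_path_increases:
  assumes "(x, y) \<in> (steep_edges E \<omega> f)\<^sup>*" "grad_norm E \<omega> f > 0"
  shows "f x \<le> f y"
  using assms by (induction rule: rtrancl_induct) (auto dest: steep_edge_increases)

section \<open>Ends of steep paths and the eigenvalue\<close>

text \<open>A steep edge into \<open>v\<close> makes the negative part of the gradient at \<open>v\<close> as large as possible; a
  nonpositive \<open>\<infinity>\<close>-Laplacian transfers this to the positive part.\<close>

lemma steep_edge_continues:
  assumes steep: "(u, v) \<in> steep_edges E \<omega> f" and L: "grad_norm E \<omega> f > 0"
    and lap: "inf_laplacian E \<omega> f v \<le> 0"
  shows "\<exists>w. (v, w) \<in> steep_edges E \<omega> f"
proof -
  have uv: "(u, v) \<in> E" "grad \<omega> f u v = grad_norm E \<omega> f"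
    using steep by (auto simp: steep_edges_def)
  have vu: "(v, u) \<in> E" using uv sym_E by (blast dest: symD)
  obtain w where w: "(v, w) \<in> E" "local_norm_pos E \<omega> f v = max (grad \<omega> f v w) 0"
    using local_norm_pos_attained[OF vu] by blast
  have "grad_norm E \<omega> f \<le> local_norm_neg E \<omega> f v"
    using neg_grad_le_local_norm_neg[OF vu, of f] grad_swap[OF uv(1), of f] uv(2) by simp
  with lap w L have "grad_norm E \<omega> f \<le> grad \<omega> f v w"
    by (auto simp: inf_laplacian_def max_def split: if_splits)
  with abs_grad_le_grad_norm[OF w(1), of f] w(1) show ?thesis
    by (auto simp: steep_edges_def)
qed

text \<open>The walk along steep edges is not constructed: a node of largest value among those
  reachable from \<open>b\<close> has no steep edge out of it.\<close>

lemma exists_top: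
  assumes sol: "inf_eigen_solution \<Lambda> f" and L: "grad_norm E \<omega> f > 0"
    and ab: "(a, b) \<in> steep_edges E \<omega> f"
  shows "\<exists>y\<in>V. (b, y) \<in> (steep_edges E \<omega> f)\<^sup>* \<and>
           (y \<in> B \<or> f y > 0 \<and> \<Lambda> * f y = grad_norm E \<omega> f)"
proof -
  define R where "R = {y \<in> V. (b, y) \<in> (steep_edges E \<omega> f)\<^sup>*}"
  have in_V: "u \<in> V" "v \<in> V" if "(u, v) \<in> steep_edges E \<omega> f" for u v
    using that E_subset by (auto simp: steep_edges_def)
  have "b \<in> R" using in_V(2)[OF ab] by (simp add: R_def)
  then have "finite R" "R \<noteq> {}"
    using finite_V by (auto simp: R_def)
  then have "Max (f ` R) \<in> f ` R" by (intro Max_in) auto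
  then obtain y where y: "y \<in> R" and y_max: "f y = Max (f ` R)" by auto
  have max: "f z \<le> f y" if "z \<in> R" for z
    unfolding y_max using \<open>finite R\<close> that by (intro Max_ge) auto
  have no_exit: "(y, z) \<notin> steep_edges E \<omega> f" for z
  proof
    assume yz: "(y, z) \<in> steep_edges E \<omega> f"
    then have "z \<in> R" using y in_V by (auto simp: R_def intro: rtrancl_into_rtrancl)
    then show False using max steep_edge_increases[OF yz L] by fastforce
  qed
  \<comment> \<open>Starting with the edge into \<open>b\<close> ensures that \<open>y\<close> has a steep edge into it even if \<open>y = b\<close>.\<close>
  have "(a, y) \<in> (steep_edges E \<omega> f)\<^sup>+"
    using ab y by (auto simp: R_def)
  then obtain u where uy: "(u, y) \<in> steep_edges E \<omega> f"
    by (meson tranclE)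
  have "f y > 0 \<and> \<Lambda> * f y = grad_norm E \<omega> f" if "y \<notin> B"
  proof -
    have yI: "y \<in> V - B" using y that by (simp add: R_def)
    have lap: "inf_laplacian E \<omega> f y > 0"
      using steep_edge_continues[OF uy L] no_exit by fastforce
    with sol[unfolded inf_eigen_solution_def, THEN bspec, OF yI]
    have "f y > 0" and eq: "local_norm E \<omega> f y = \<Lambda> * f y"
      by (simp_all add: min_def max_def split: if_splits)
    moreover have "local_norm E \<omega> f y = grad_norm E \<omega> f"
    proof (rule antisym)
      have uy': "(u, y) \<in> E" "grad \<omega> f u y = grad_norm E \<omega> f"
        using uy by (auto simp: steep_edges_def)
      have yu: "(y, u) \<in> E" using uy' sym_E by (blast dest: symD)
      show "local_norm E \<omega> f y \<le> grad_norm E \<omega> f" by (rule local_norm_le_grad_norm[OF yu])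
      show "grad_norm E \<omega> f \<le> local_norm E \<omega> f y"
        using abs_grad_le_local_norm[OF yu, of f] grad_swap[OF uy'(1), of f] uy'(2) L by simp
    qed
    ultimately show ?thesis by simp
  qed
  then show ?thesis using y unfolding R_def by blast
qed

lemma exists_bottom:
  assumes sol: "inf_eigen_solution \<Lambda> f" and L: "grad_norm E \<omega> f > 0"
    and ab: "(a, b) \<in> steep_edges E \<omega> f"
  shows "\<exists>x\<in>V. (x, a) \<in> (steep_edges E \<omega> f)\<^sup>* \<and>
           (x \<in> B \<or> f x < 0 \<and> \<Lambda> * f x = - grad_norm E \<omega> f)"
proof -
  have "(b, a) \<in> steep_edges E \<omega> (\<lambda>u. - f u)"
    using ab by (simp add: steep_edges_uminus)
  from exists_top[OF inf_eigen_solution_uminus[OF sol] _ this] L show ?thesis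
    by (auto simp: steep_edges_uminus grad_norm_uminus rtrancl_converse minus_equation_iff)
qed

lemma exists_neighbour:
  assumes "E \<noteq> {}" "u \<in> V - B"
  shows "\<exists>v. (u, v) \<in> E"
proof -
  obtain a b where ab: "(a, b) \<in> E" using assms(1) by auto
  have refl: "\<exists>v. (u, v) \<in> E" if "(u, w) \<in> E\<^sup>*" "w \<noteq> u" for w
    using that by (cases rule: converse_rtranclE) auto
  show ?thesis
  proof (cases "B = {}")
    case True
    then have "(u, a) \<in> E\<^sup>*"
      using connected_no_boundary assms(2) ab E_subset by blast
    then show ?thesis using refl ab by blast
  next
    case False
    then obtain w c where wc: "w \<in> V - B" "(w, c) \<in> E"
      using boundary_adjacent by blast
    then have "(u, w) \<in> (E \<inter> (V - B) \<times> (V - B))\<^sup>*"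
      using connected_internal False assms(2) by blast
    then have "(u, w) \<in> E\<^sup>*" by (rule rtrancl_mono[THEN subsetD, rotated]) auto
    then show ?thesis using refl wc by blast
  qed
qed

text \<open>Whichever term of the minimum or maximum vanishes, the first one has a known sign, so
  \<open>\<Lambda> * \<bar>f u\<bar>\<close> never exceeds the local norm. This is used where \<open>\<bar>f\<bar>\<close> is maximal.\<close>

lemma eigenvalue_sup_norm_le:
  assumes f: "f \<in> H0 V B" and sol: "inf_eigen_solution \<Lambda> f" and L: "grad_norm E \<omega> f > 0"
    and "E \<noteq> {}"
  shows "\<Lambda> * sup_norm V f \<le> grad_norm E \<omega> f"
proof -
  obtain u where u: "u \<in> V" "sup_norm V f = \<bar>f u\<bar>"
    by (rule sup_norm_attained)
  show ?thesis
  proof (cases "f u = 0")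
    case True
    then show ?thesis using u L by simp
  next
    case False
    then have uI: "u \<in> V - B" using zero_on_boundary[OF f] by blast
    have "\<Lambda> * \<bar>f u\<bar> \<le> local_norm E \<omega> f u"
      using sol[unfolded inf_eigen_solution_def, THEN bspec, OF uI] False
      by (cases "f u > 0") (simp_all add: min_def max_def split: if_splits)
    then show ?thesis
      using exists_neighbour[OF \<open>E \<noteq> {}\<close> uI] local_norm_le_grad_norm[of u _ f] u
      by fastforce
  qed
qed

section \<open>Dipoles as common subgradients\<close>

lemma dipole_in_H0: "dipole (V - B) c x y \<in> H0 V B"
  by (auto simp: H0_def dipole_def)

lemma sum_dipole:
  assumes "h \<in> H0 V B"
  shows "(\<Sum>u\<in>V - B. dipole (V - B) c x y u * h u) = c * (h y - h x)"
proof -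
  have pick: "(\<Sum>u\<in>V - B. of_bool (u = z) * h u) = h z" for z
    using finite_V zero_on_boundary[OF assms, of z] by (simp add: of_bool_def if_distrib sum.delta'
        if_distribR cong: if_cong)
  have "(\<Sum>u\<in>V - B. dipole (V - B) c x y u * h u)
      = (\<Sum>u\<in>V - B. c * (of_bool (u = y) * h u - of_bool (u = x) * h u))"
    by (rule sum.cong) (auto simp: dipole_def algebra_simps)
  also have "\<dots> = c * (h y - h x)"
    by (simp only: sum_distrib_left[symmetric] sum_subtractf pick)
  finally show ?thesis .
qed

lemma dipole_subgradient:
  assumes f: "f \<in> H0 V B"
    and below: "\<And>g. g \<in> H0 V B \<Longrightarrow> c * (g y - g x) \<le> J g"
    and touch: "c * (f y - f x) = J f"
  shows "dipole (V - B) c x y \<in> subdifferential V B J f"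
proof -
  have "J f + (\<Sum>u\<in>V - B. dipole (V - B) c x y u * (g u - f u)) = c * (g y - g x)"
    if "g \<in> H0 V B" for g
    using sum_dipole[OF that, of c x y] sum_dipole[OF f, of c x y] touch
    by (simp add: right_diff_distrib sum_subtractf)
  then show ?thesis
    using below dipole_in_H0 by (auto simp: subdifferential_def)
qed

end

theorem corollary4p9:
  fixes V :: "'v set" and E :: "('v \<times> 'v) set" and \<omega> :: "'v \<Rightarrow> 'v \<Rightarrow> real" and B :: "'v set"
    and f :: "'v \<Rightarrow> real" and \<Lambda> :: real
  assumes "weighted_boundary_graph V E \<omega> B"
    and "f \<in> H0 V B"
    and "\<not> (\<exists>c. \<forall>u\<in>V. f u = c)"
    and "\<forall>u\<in>V - B.
      0 = (if f u > 0 then min (local_norm E \<omega> f u - \<Lambda> * f u) (inf_laplacian E \<omega> f u)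
           else if f u = 0 then inf_laplacian E \<omega> f u
           else max (- local_norm E \<omega> f u - \<Lambda> * f u) (inf_laplacian E \<omega> f u))"
  shows "generalized_inf_eigenpair V E \<omega> B f \<Lambda>"
proof -
  interpret weighted_boundary_graph V E \<omega> B by (rule assms(1))
  note f = assms(2)
  have sol: "inf_eigen_solution \<Lambda> f"
    unfolding inf_eigen_solution_def by (rule assms(4))
  define L where "L = grad_norm E \<omega> f"
  define M where "M = sup_norm V f"
  have L: "L > 0"
    unfolding L_def by (rule exists_steep_edge(1)[OF assms(2,3)])
  obtain a b where ab: "(a, b) \<in> steep_edges E \<omega> f"
    using exists_steep_edge(2)[OF assms(2,3)] by auto
  obtain y where y: "y \<in> V" "(b, y) \<in> (steep_edges E \<omega> f)\<^sup>*"
      "y \<in> B \<or> f y > 0 \<and> \<Lambda> * f y = L"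
    using exists_top[OF sol _ ab] L unfolding L_def by blast
  obtain x where x: "x \<in> V" "(x, a) \<in> (steep_edges E \<omega> f)\<^sup>*"
      "x \<in> B \<or> f x < 0 \<and> \<Lambda> * f x = - L"
    using exists_bottom[OF sol _ ab] L unfolding L_def by blast
  have xy: "(x, y) \<in> (steep_edges E \<omega> f)\<^sup>*"
    using x(2) ab y(2) by (meson rtrancl.rtrancl_into_rtrancl rtrancl_trans)
  have less: "f x < f y"
    using steep_path_increases[OF x(2)] steep_path_increases[OF y(2)]
      steep_edge_increases[OF ab] L unfolding L_def by fastforce
  have boundary: "f z = 0" if "z \<in> B" for z
    using zero_on_boundary[OF f] that by blast

  have end_values: "z \<in> B \<or> \<Lambda> * \<bar>f z\<bar> = L" if "z \<in> {x, y}" for z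
    using that x(3) y(3) by auto
  have signs: "f x \<le> 0" "0 \<le> f y"
    using x(3) y(3) boundary by force+
  have \<Lambda>: "\<Lambda> > 0"
  proof -
    have "\<exists>z\<in>{x, y}. z \<notin> B" using less boundary by fastforce
    then obtain z where "\<Lambda> * \<bar>f z\<bar> = L" using end_values by blast
    then show ?thesis using L by (metis abs_ge_zero mult_nonpos_nonneg not_less)
  qed
  have M_le: "\<Lambda> * M \<le> L"
    unfolding L_def M_def
    using eigenvalue_sup_norm_le[OF f sol] L ab by (auto simp: L_def steep_edges_def)
  have extremal: "z \<in> B \<or> \<bar>f z\<bar> = M \<and> \<Lambda> * M = L" if "z \<in> {x, y}" for z
  proof (cases "z \<in> B")
    case False
    then have eq: "\<Lambda> * \<bar>f z\<bar> = L" using end_values that by blast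
    have "z \<in> V" using that x(1) y(1) by blast
    then have "\<bar>f z\<bar> \<le> M" unfolding M_def by (rule abs_le_sup_norm)
    moreover have "M \<le> \<bar>f z\<bar>" using M_le \<Lambda> unfolding eq[symmetric] by simp
    ultimately show ?thesis using eq by auto
  qed simp
  have LM: "\<Lambda> * M = L"
    using extremal[of x] extremal[of y] less boundary by fastforce

  define D where "D = f y - f x"
  have D: "D > 0" using less by (simp add: D_def)
  have grad_subgradient:
    "dipole (V - B) (L / D) x y \<in> subdifferential V B (grad_norm E \<omega>) f"
  proof (rule dipole_subgradient[OF f])
    show "L / D * (g y - g x) \<le> grad_norm E \<omega> g" for g
      using steep_path_increment[OF xy, of g] D
      by (simp add: L_def[symmetric] D_def[symmetric] field_simps)
    show "L / D * (f y - f x) = grad_norm E \<omega> f"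
      using D by (simp add: D_def[symmetric] L_def)
  qed
  have sup_subgradient:
    "dipole (V - B) (M / D) x y \<in> subdifferential V B (sup_norm V) f"
  proof (rule dipole_subgradient[OF f])
    fix g assume g: "g \<in> H0 V B"
    have bound: "M * \<bar>g z\<bar> \<le> sup_norm V g * \<bar>f z\<bar>" if "z \<in> {x, y}" for z
    proof (cases "z \<in> B")
      case True
      then show ?thesis using boundary zero_on_boundary[OF g, of z] by simp
    next
      case False
      then have "\<bar>f z\<bar> = M" using extremal that by blast
      moreover have "\<bar>g z\<bar> \<le> sup_norm V g" using that x(1) y(1) abs_le_sup_norm by blast
      ultimately show ?thesis using mult_right_mono[of "\<bar>g z\<bar>" "sup_norm V g" M]
        by (simp add: mult.commute)
    qed
    have "0 \<le> M" using LM L \<Lambda> by (metis less_imp_le zero_less_mult_pos)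
    then have "M * (g y - g x) \<le> M * (\<bar>g y\<bar> + \<bar>g x\<bar>)"
      by (intro mult_left_mono) auto
    also have "\<dots> \<le> sup_norm V g * (\<bar>f y\<bar> + \<bar>f x\<bar>)"
      using bound[of x] bound[of y] by (simp add: distrib_left)
    also have "\<bar>f y\<bar> + \<bar>f x\<bar> = D" using signs by (simp add: D_def)
    finally show "M / D * (g y - g x) \<le> sup_norm V g"
      using D by (simp add: field_simps)
  next
    show "M / D * (f y - f x) = sup_norm V f"
      using D by (simp add: D_def[symmetric] M_def)
  qed
  have "dipole (V - B) (L / D) x y = (\<lambda>u. \<Lambda> * dipole (V - B) (M / D) x y u)"
    by (auto simp: dipole_def LM[symmetric])
  then show ?thesis
    unfolding generalized_inf_eigenpair_def using grad_subgradient sup_subgradient by blast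
qed

end
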